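(* Let $H$ be a real Hilbert space, let $U:H\to H$ be a linear operator of operator norm at most one, let $v\in H$, and let $T:H\to H$ be the (nonexpansive) map $Tx=Ux+v$. Suppose that $0\notin\overline{\mathrm{Im}(I-T)}$, where $\mathrm{Im}(I-T)=\{x-Tx : x\in H\}$ and the closure is taken in norm. Then there is a non-zero continuous linear functional $f:H\to\mathbb{R}$ such that $$f(Tx)\geq f(x)\quad\text{for all } x\in H.$$ Moreover, for any non-zero continuous linear functional $f$ on $H$ satisfying this inequality, $\ker(f)$ is a closed linear subspace of $H$ with $\ker(f)\neq H$ which is invariant under $U$ (that is, $U(\ker f)\subseteq\ker f$), and, if $\dim H\geq 2$, also $\ker(f)\neq\{0\}$; i.e. $\ker(f)$ is a non-trivial closed invariant subspace for $U$.
   Context: A map $T$ of a normed space into itself is nonexpansive if $\|Tx-Ty\|\leq\|x-y\|$ for all $x,y$. A closed invariant subspace is called non-trivial if it is neither $\{0\}$ nor the whole space. *)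

theory Defs
  imports "HOL-Analysis.Analysis"
begin

text \<open>
  The library's \<^const>\<open>dim\<close> is \<open>0\<close> for a space without a finite basis, so \<open>2 \<le> dim UNIV\<close> would
  exclude the infinite-dimensional spaces. The dimension of a subspace \<open>V\<close> (the cardinality of a
  Hamel basis, possibly infinite) is therefore bounded below as follows.
\<close>

definition dim_at_least :: "nat \<Rightarrow> 'a::real_vector set \<Rightarrow> bool" where
  "dim_at_least n V \<longleftrightarrow>
     (\<exists>B. B \<subseteq> V \<and> independent B \<and> V \<subseteq> span B \<and> (infinite B \<or> n \<le> card B))"

end

theory Submission
  imports Defs
begin

text \<open>
  Since \<open>U\<close> is linear, \<open>x - T x = (x - U x) - v\<close> runs through an affine subspace, so the closure
  \<open>C\<close> of these displacements is convex. In a Hilbert space \<open>C\<close> has an element \<open>w\<close> of least norm, and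
  the whole of \<open>C\<close> lies in the half-space \<open>w \<bullet> c \<ge> w \<bullet> w\<close>, as \<open>w\<close> is the point of \<open>C\<close> closest to
  the origin (lemmas \<open>exists_min_norm_in_closed_convex\<close> and \<open>any_closest_point_dot\<close>). As \<open>0 \<notin> C\<close>, the
  vector \<open>w\<close> is non-zero, and \<open>f x = - (w \<bullet> x)\<close> strictly increases along \<open>T\<close>.

  Conversely, let \<open>f (T x) \<ge> f x\<close> for all \<open>x\<close>. Then the linear functional \<open>x \<mapsto> f (U x) - f x\<close> is
  bounded below by the constant \<open>- f v\<close>. A linear functional that is bounded below vanishes
  identically, so \<open>f \<circ> U = f\<close>, and the kernel of \<open>f\<close> is invariant under \<open>U\<close>. It is non-zero in
  dimension at least two because no linear map into the one-dimensional space of reals is then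
  injective.
\<close>

text \<open>
  The points \<open>x\<close> of \<open>C\<close> with \<open>x \<bullet> x\<close> within \<open>1 / Suc n\<close> of the infimum form nested closed
  sets. Their diameters tend to \<open>0\<close> by the parallelogram law, because the midpoint of two such points
  again lies in \<open>C\<close>. By completeness the sets have a common point.
\<close>

lemma exists_min_norm_in_closed_convex:
  fixes C :: "'a::{real_inner, complete_space} set"
  assumes "closed C" "convex C" "C \<noteq> {}"
  obtains w where "w \<in> C" "\<And>x. x \<in> C \<Longrightarrow> norm w \<le> norm x"
proof -
  define d where "d = (INF x\<in>C. x \<bullet> x)"
  define S where "S n = {x \<in> C. x \<bullet> x \<le> d + 1 / real (Suc n)}" for n
  have bdd: "bdd_below ((\<lambda>x. x \<bullet> x) ` C)"
    by (rule bdd_belowI2[where m = 0]) simp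
  have d_le: "d \<le> x \<bullet> x" if "x \<in> C" for x
    unfolding d_def using bdd that by (rule cINF_lower)
  have closed_S: "closed (S n)" for n
  proof -
    have "S n = C \<inter> {x. x \<bullet> x \<le> d + 1 / real (Suc n)}"
      by (auto simp: S_def)
    then show ?thesis
      using \<open>closed C\<close> by (auto intro!: closed_Int closed_Collect_le continuous_intros)
  qed
  have nonempty_S: "S n \<noteq> {}" for n
  proof -
    have "(INF x\<in>C. x \<bullet> x) < d + 1 / real (Suc n)"
      by (simp add: d_def)
    then obtain x where "x \<in> C" "x \<bullet> x < d + 1 / real (Suc n)"
      using cINF_less_iff[OF \<open>C \<noteq> {}\<close> bdd] by blast
    then have "x \<in> S n"
      by (simp add: S_def)
    then show ?thesis
      by blast
  qed
  have nested_S: "S n \<subseteq> S m" if "m \<le> n" for m n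
  proof -
    have "1 / real (Suc n) \<le> 1 / real (Suc m)"
      using that by (intro divide_left_mono) auto
    then show ?thesis
      unfolding S_def by force
  qed
  have diam_S: "(dist x y)\<^sup>2 \<le> 4 / real (Suc n)" if "x \<in> S n" "y \<in> S n" for x y n
  proof -
    have "(1/2) *\<^sub>R x + (1/2) *\<^sub>R y \<in> C"
      using that \<open>convex C\<close> by (intro convexD) (auto simp: S_def)
    then have "d \<le> ((1/2) *\<^sub>R x + (1/2) *\<^sub>R y) \<bullet> ((1/2) *\<^sub>R x + (1/2) *\<^sub>R y)"
      by (rule d_le)
    moreover have "(dist x y)\<^sup>2 + 4 * (((1/2) *\<^sub>R x + (1/2) *\<^sub>R y) \<bullet> ((1/2) *\<^sub>R x + (1/2) *\<^sub>R y))
        = 2 * (x \<bullet> x) + 2 * (y \<bullet> y)"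
      by (simp add: dist_norm power2_norm_eq_inner inner_simps inner_commute)
    moreover have "x \<bullet> x \<le> d + 1 / real (Suc n)" "y \<bullet> y \<le> d + 1 / real (Suc n)"
      using that by (auto simp: S_def)
    ultimately have "(dist x y)\<^sup>2 \<le> 4 * (1 / real (Suc n))"
      by linarith
    then show ?thesis
      by simp
  qed
  have small_S: "\<exists>n. \<forall>x\<in>S n. \<forall>y\<in>S n. dist x y < e" if "e > 0" for e
  proof -
    have "0 < e\<^sup>2 / 4"
      using \<open>e > 0\<close> by simp
    then obtain n where "1 / real (Suc n) < e\<^sup>2 / 4"
      by (rule nat_approx_posE)
    then have "4 / real (Suc n) < e\<^sup>2"
      by (simp add: field_simps)
    then have "dist x y < e" if "x \<in> S n" "y \<in> S n" for x y
      using diam_S[OF that] \<open>e > 0\<close> by (intro power2_less_imp_less[of _ e]) auto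
    then show ?thesis
      by blast
  qed
  obtain w where w: "\<And>n. w \<in> S n"
    using decreasing_closed_nest[of S] closed_S nonempty_S nested_S small_S by metis
  then have "w \<in> C"
    by (simp add: S_def)
  have "w \<bullet> w \<le> d"
  proof (rule field_le_epsilon)
    fix e :: real
    assume "0 < e"
    then obtain n where "1 / real (Suc n) < e"
      by (rule nat_approx_posE)
    then show "w \<bullet> w \<le> d + e"
      using w[of n] by (simp add: S_def)
  qed
  then have "norm w \<le> norm x" if "x \<in> C" for x
    using d_le[OF that] by (simp add: norm_eq_sqrt_inner)
  with \<open>w \<in> C\<close> show ?thesis
    by (rule that)
qed

text \<open>By linearity, a negative value could be scaled below any given bound.\<close>

lemma linear_functional_bounded_below_eq_0:
  fixes g :: "'a::real_vector \<Rightarrow> real"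
  assumes "linear g" and bound: "\<And>x. c \<le> g x"
  shows "g x = 0"
proof (rule ccontr)
  assume "g x \<noteq> 0"
  then have "g (((c - 1) / g x) *\<^sub>R x) = c - 1"
    using \<open>linear g\<close> by (simp add: linear_scale)
  then show False
    using bound[of "((c - 1) / g x) *\<^sub>R x"] by simp
qed

text \<open>
  For independent \<open>a\<close> and \<open>b\<close>, the vector \<open>f b *\<^sub>R a - f a *\<^sub>R b\<close> lies in the kernel. Either it is
  non-zero, or both coefficients vanish and \<open>b\<close> itself lies in the kernel.
\<close>

lemma kernel_nonzero_of_dim_at_least_2:
  fixes f :: "'a::real_vector \<Rightarrow> real"
  assumes "linear f" and "dim_at_least 2 (UNIV :: 'a set)"
  shows "{x. f x = 0} \<noteq> {0}"
proof
  assume ker: "{x. f x = 0} = {0}"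
  obtain B :: "'a set" where "independent B" and B: "infinite B \<or> 2 \<le> card B"
    using assms(2) unfolding dim_at_least_def by blast
  obtain D where "D \<subseteq> B" "card D = 2" "finite D"
    using B infinite_arbitrarily_large[of B 2] obtain_subset_with_card_n[of 2 B] by metis
  then obtain a b where "a \<in> B" "b \<in> B" "a \<noteq> b"
    by (auto simp: card_2_iff)
  have indep_ab: "independent {a, b}"
    using \<open>independent B\<close> by (rule independent_mono) (simp add: \<open>a \<in> B\<close> \<open>b \<in> B\<close>)
  have "f (f b *\<^sub>R a - f a *\<^sub>R b) = 0"
    using \<open>linear f\<close> by (simp add: linear_diff linear_scale)
  then have dep: "f b *\<^sub>R a - f a *\<^sub>R b = 0"
    using ker by blast
  have "f b = 0"
  proof (rule ccontr)
    assume "f b \<noteq> 0"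
    moreover have "f b *\<^sub>R a = f a *\<^sub>R b"
      using dep by simp
    ultimately have "a = (f a / f b) *\<^sub>R b"
      by (metis divide_inverse_commute left_inverse scaleR_one scaleR_scaleR)
    then have "a \<in> span {b}"
      by (metis span_base span_scale singletonI)
    then show False
      using indep_ab \<open>a \<noteq> b\<close> by (simp add: independent_insert)
  qed
  then have "b = 0"
    using ker by blast
  then show False
    using \<open>independent B\<close> \<open>b \<in> B\<close> dependent_zero by blast
qed

theorem theorem3p1:
  fixes U T :: "'a::{real_inner, complete_space} \<Rightarrow> 'a" and v :: 'a
  assumes "bounded_linear U" and "onorm U \<le> 1"
    and "\<And>x. T x = U x + v"
    and "0 \<notin> closure (range (\<lambda>x. x - T x))"
  shows "(\<exists>f :: 'a \<Rightarrow> real. bounded_linear f \<and> f \<noteq> (\<lambda>x. 0) \<and> (\<forall>x. f (T x) \<ge> f x)) \<and>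
    (\<forall>f :: 'a \<Rightarrow> real. bounded_linear f \<and> f \<noteq> (\<lambda>x. 0) \<and> (\<forall>x. f (T x) \<ge> f x) \<longrightarrow>
       closed {x. f x = 0} \<and> subspace {x. f x = 0} \<and> {x. f x = 0} \<noteq> UNIV \<and>
       U ` {x. f x = 0} \<subseteq> {x. f x = 0} \<and>
       (dim_at_least 2 (UNIV :: 'a set) \<longrightarrow> {x. f x = 0} \<noteq> {0}))"
proof (intro conjI allI impI)
  have "linear U"
    using assms(1) by (rule bounded_linear.linear)
  define C where "C = closure (range (\<lambda>x. x - T x))"
  have "range (\<lambda>x. x - T x) = (\<lambda>y. - v + y) ` range (\<lambda>x. x - U x)"
    by (simp add: image_image assms(3) algebra_simps)
  moreover have "convex (range (\<lambda>x. x - U x))"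
    using \<open>linear U\<close> by (intro convex_linear_image linear_compose_sub linear_ident) simp_all
  ultimately have "convex C"
    unfolding C_def by (simp add: convex_closure convex_translation)
  obtain w where "w \<in> C" and min: "\<And>x. x \<in> C \<Longrightarrow> norm w \<le> norm x"
    using exists_min_norm_in_closed_convex[of C] \<open>convex C\<close> by (auto simp: C_def)
  have "w \<noteq> 0"
    using \<open>w \<in> C\<close> assms(4) by (auto simp: C_def)
  have increasing: "- (w \<bullet> T x) \<ge> - (w \<bullet> x)" for x
  proof -
    have "x - T x \<in> C"
      unfolding C_def by (intro subsetD[OF closure_subset]) simp
    then have "(0 - w) \<bullet> (x - T x - w) \<le> 0"
      using \<open>convex C\<close> \<open>w \<in> C\<close> min
      by (intro any_closest_point_dot[where S = C]) (auto simp: C_def)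
    then have "w \<bullet> w \<le> w \<bullet> (x - T x)"
      by (simp add: inner_diff_right)
    moreover have "0 \<le> w \<bullet> w"
      by simp
    ultimately have "0 \<le> w \<bullet> (x - T x)"
      by linarith
    then show ?thesis
      by (simp add: inner_diff_right)
  qed
  have "bounded_linear (\<lambda>x. - (w \<bullet> x))"
    by (intro bounded_linear_minus bounded_linear_inner_right)
  moreover have "(\<lambda>x. - (w \<bullet> x)) \<noteq> (\<lambda>x. 0)"
    using \<open>w \<noteq> 0\<close> by (metis inner_eq_zero_iff neg_equal_0_iff_equal)
  ultimately show "\<exists>f :: 'a \<Rightarrow> real. bounded_linear f \<and> f \<noteq> (\<lambda>x. 0) \<and> (\<forall>x. f (T x) \<ge> f x)"
    using increasing by blast
next
  fix f :: "'a \<Rightarrow> real"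
  assume f: "bounded_linear f \<and> f \<noteq> (\<lambda>x. 0) \<and> (\<forall>x. f (T x) \<ge> f x)"
  then have "linear f"
    by (blast intro: bounded_linear.linear)
  have "linear U"
    using assms(1) by (rule bounded_linear.linear)
  show "closed {x. f x = 0}"
    using f by (intro closed_Collect_eq) (auto intro: linear_continuous_on)
  show "subspace {x. f x = 0}"
    by (simp add: subspace_def linear_0[OF \<open>linear f\<close>] linear_add[OF \<open>linear f\<close>]
        linear_scale[OF \<open>linear f\<close>])
  show "{x. f x = 0} \<noteq> UNIV"
    using f by auto
  have "f (U x) - f x = 0" for x
  proof (rule linear_functional_bounded_below_eq_0[where
        g = "\<lambda>x. f (U x) - f x" and c = "- f v"])
    show "linear (\<lambda>x. f (U x) - f x)"
      using linear_compose[OF \<open>linear U\<close> \<open>linear f\<close>] \<open>linear f\<close>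
      by (auto simp: o_def intro: linear_compose_sub)
    show "- f v \<le> f (U x) - f x" for x
    proof -
      have "f x \<le> f (T x)"
        using f by blast
      then show ?thesis
        by (simp add: assms(3) linear_add[OF \<open>linear f\<close>])
    qed
  qed
  then show "U ` {x. f x = 0} \<subseteq> {x. f x = 0}"
    by auto
  show "{x. f x = 0} \<noteq> {0}" if "dim_at_least 2 (UNIV :: 'a set)"
    using \<open>linear f\<close> that by (rule kernel_nonzero_of_dim_at_least_2)
qed

end
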